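(* Let $0<p\le1$, $q>1$, $\beta>0$, $\epsilon\ge0$. Let $\bm{A}\in\mathbb{R}^{m\times n}$, $\bm{b}\in\mathbb{R}^m$, and let $\bm{x}\in\mathbb{R}^n$, $\bm{x}\ne\bm{0}$, satisfy $\|\bm{b}-\bm{A}\bm{x}\|_2\le\epsilon$ and $\frac{\|\bm{x}\|_p}{\|\bm{x}\|_q}\le\beta$. Let $\hat{\bm{x}}$ be a solution (global minimizer) of $$\inf_{\bm{z}\in\mathbb{R}^n\setminus\{\bm{0}\}}\left\{\frac{\|\bm{z}\|_p^p}{\|\bm{z}\|_q^p}\;\middle|\;\|\bm{A}\bm{z}-\bm{b}\|_2\le\epsilon\right\}.$$ Let $1\le k<n$ and $1\le t\le n-k$ be integers. Define $a_p:=3^{\frac{1-p}{p}}$, $\vartheta_q:=\max\{\frac1q-\frac12,0\}$, $$\widetilde\eta:=a_p\,\beta\,k^{\frac{p-1}{p}}t^{\vartheta_q-\frac12},\qquad\widetilde\tau:=\frac{a_p\sqrt{\frac kt}+\frac14\sqrt{\frac tk}+a_p\,\beta\,k^{\frac{p-1}{p}+\vartheta_q}t^{-\frac12}}{1-\widetilde\eta},\qquad\widetilde\psi:=\delta_k+\widetilde\tau\,\theta_{k,t}.$$ If $\bm{A}$ satisfies the $k$-RIP with constant $\delta_k$ and the $(k,t)$-ROP with constant $\theta_{k,t}$, and $\widetilde\eta<1$ and $\widetilde\psi<1$, then $$\|\hat{\bm{x}}-\bm{x}\|_2\le\widetilde C_1\|\bm{x}_{-\max(k)}\|_p+\widetilde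 C_2\epsilon,$$ where $$\widetilde C_1=\frac{a_p\,2^{\frac1p}k^{\frac{p-1}{p}}t^{-\frac12}(1-\delta_k+\theta_{k,t})}{(1-\widetilde\eta)(1-\widetilde\psi)},\qquad\widetilde C_2=\frac{2(1+\widetilde\tau)\sqrt{1+\delta_k}}{1-\widetilde\psi}.$$
   Context: For $0<r<\infty$, $\|\bm{u}\|_r:=(\sum_i|u_i|^r)^{1/r}$ (a quasi-norm if $r<1$). $\bm{x}_{\max(k)}$ is obtained from $\bm{x}$ by keeping its $k$ largest entries in magnitude and setting the others to zero; $\bm{x}_{-\max(k)}:=\bm{x}-\bm{x}_{\max(k)}$. A vector is $s$-sparse if it has at most $s$ nonzero entries. Restricted isometry constant (RIC) $\delta_s$ of $\bm{A}$: the smallest number such that $(1-\delta_s)\|\bm{u}\|_2^2\le\|\bm{A}\bm{u}\|_2^2\le(1+\delta_s)\|\bm{u}\|_2^2$ for all $s$-sparse $\bm{u}$; $\bm{A}$ satisfies the $s$-RIP if $\delta_s\in[0,1)$. Restricted orthogonality constant (ROC) $\theta_{s_1,s_2}$ of $\bm{A}$: the smallest nonnegative number such that $|\langle\bm{A}\bm{u},\bm{A}\bm{v}\rangle|\le\theta_{s_1,s_2}\|\bm{u}\|_2\|\bm{v}\|_2$ for all $s_1$-sparse $\bm{u}$ and $s_2$-sparse $\bm{v}$ with disjoint supports; $\bm{A}$ is then said to satisfy the $(s_1,s_2)$-ROP with ROC $\theta_{s_1,s_2}$. *)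

theory Defs
  imports "HOL-Analysis.Analysis"
begin

definition lp_norm :: "real \<Rightarrow> real ^ 'n \<Rightarrow> real" where
  "lp_norm r u = (\<Sum>i\<in>UNIV. \<bar>u $ i\<bar> powr r) powr (1 / r)"

definition supp :: "real ^ 'n \<Rightarrow> 'n set" where
  "supp u = {i. u $ i \<noteq> 0}"

definition sparse :: "nat \<Rightarrow> real ^ 'n \<Rightarrow> bool" where
  "sparse s u \<longleftrightarrow> card (supp u) \<le> s"

text \<open>
  The vector \<open>y\<close> arises from \<open>x\<close> by keeping \<open>k\<close> entries of largest magnitude.  Ties make
  this a relation rather than a function: any tie-breaking is admitted.
\<close>

definition is_max_part :: "nat \<Rightarrow> real ^ 'n \<Rightarrow> real ^ 'n \<Rightarrow> bool" where
  "is_max_part k x y \<longleftrightarrow>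
     (\<exists>S. card S = k \<and> (\<forall>i\<in>S. \<forall>j\<in>- S. \<bar>x $ j\<bar> \<le> \<bar>x $ i\<bar>)
        \<and> y = (\<chi> i. if i \<in> S then x $ i else 0))"

lemma is_max_part_exists:
  fixes x :: "real ^ 'n"
  assumes "k \<le> CARD('n)"
  shows "\<exists>y. is_max_part k x y"
proof -
  have "\<exists>S. card S = k \<and> (\<forall>i\<in>S. \<forall>j\<in>- S. \<bar>x $ j\<bar> \<le> \<bar>x $ i\<bar>)"
    using assms
  proof (induction k)
    case 0
    show ?case by (rule exI[of _ "{}"]) simp
  next
    case (Suc k)
    then obtain S where S: "card S = k" "\<forall>i\<in>S. \<forall>j\<in>- S. \<bar>x $ j\<bar> \<le> \<bar>x $ i\<bar>"
      by auto
    have ne: "- S \<noteq> {}"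
      using S(1) Suc.prems by (metis Compl_empty_eq double_compl Suc_n_not_le_n)
    define m where "m = Max ((\<lambda>i. \<bar>x $ i\<bar>) ` (- S))"
    have "m \<in> (\<lambda>i. \<bar>x $ i\<bar>) ` (- S)"
      unfolding m_def using ne by (intro Max_in) auto
    then obtain a where a: "a \<in> - S" "m = \<bar>x $ a\<bar>" by blast
    have am: "\<bar>x $ j\<bar> \<le> \<bar>x $ a\<bar>" if "j \<in> - S" for j
      using that unfolding a(2)[symmetric] m_def by (intro Max_ge) auto
    show ?case
      by (rule exI[of _ "insert a S"]) (use S a am in auto)
  qed
  then show ?thesis unfolding is_max_part_def by blast
qed

text \<open>
  The sets of admissible constants are closed, bounded below (for the RIC if \<open>s \<ge> 1\<close>) and
  nonempty, so the minima below are attained; see \<open>ric_least\<close> and \<open>roc_least\<close>.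
\<close>

definition ric_bound :: "real ^ 'n ^ 'm \<Rightarrow> nat \<Rightarrow> real \<Rightarrow> bool" where
  "ric_bound A s d \<longleftrightarrow>
     (\<forall>u. sparse s u \<longrightarrow>
        (1 - d) * (norm u)\<^sup>2 \<le> (norm (A *v u))\<^sup>2 \<and> (norm (A *v u))\<^sup>2 \<le> (1 + d) * (norm u)\<^sup>2)"

definition ric :: "real ^ 'n ^ 'm \<Rightarrow> nat \<Rightarrow> real" where
  "ric A s = (LEAST d. ric_bound A s d)"

definition satisfies_RIP :: "real ^ 'n ^ 'm \<Rightarrow> nat \<Rightarrow> real \<Rightarrow> bool" where
  "satisfies_RIP A s d \<longleftrightarrow> d = ric A s \<and> 0 \<le> d \<and> d < 1"

definition roc_bound :: "real ^ 'n ^ 'm \<Rightarrow> nat \<Rightarrow> nat \<Rightarrow> real \<Rightarrow> bool" where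
  "roc_bound A s1 s2 c \<longleftrightarrow>
     0 \<le> c \<and>
     (\<forall>u v. sparse s1 u \<longrightarrow> sparse s2 v \<longrightarrow> supp u \<inter> supp v = {} \<longrightarrow>
        \<bar>(A *v u) \<bullet> (A *v v)\<bar> \<le> c * norm u * norm v)"

definition roc :: "real ^ 'n ^ 'm \<Rightarrow> nat \<Rightarrow> nat \<Rightarrow> real" where
  "roc A s1 s2 = (LEAST c. roc_bound A s1 s2 c)"

definition satisfies_ROP :: "real ^ 'n ^ 'm \<Rightarrow> nat \<Rightarrow> nat \<Rightarrow> real \<Rightarrow> bool" where
  "satisfies_ROP A s1 s2 c \<longleftrightarrow> c = roc A s1 s2"

lemma Least_closed_real:
  fixes P :: "real \<Rightarrow> bool"
  assumes "closed {d. P d}" "P d0" "\<And>d. P d \<Longrightarrow> 0 \<le> d"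
  shows "P (LEAST d. P d) \<and> (\<forall>d. P d \<longrightarrow> (LEAST d. P d) \<le> d)"
proof -
  have bdd: "bdd_below {d. P d}" using assms(3) by (intro bdd_belowI[of _ 0]) auto
  have "Inf {d. P d} \<in> {d. P d}"
    using assms(1,2) bdd by (intro closed_contains_Inf) auto
  moreover have "Inf {d. P d} \<le> d" if "P d" for d
    using that bdd by (intro cInf_lower) auto
  ultimately show ?thesis using Least_equality[of P "Inf {d. P d}"] by auto
qed

lemma ric_least:
  fixes A :: "real ^ 'n ^ 'm"
  assumes "1 \<le> s"
  shows "ric_bound A s (ric A s)" and "ric_bound A s d \<Longrightarrow> ric A s \<le> d"
proof -
  obtain K where K: "\<And>u. norm (A *v u) \<le> norm u * K" and "0 < K"
    using bounded_linear.pos_bounded[of "(*v) A"] matrix_vector_mul_bounded_linear by blast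
  have "ric_bound A s (1 + K\<^sup>2)"
    unfolding ric_bound_def
  proof (intro allI impI conjI)
    fix u :: "real ^ 'n"
    show "(1 - (1 + K\<^sup>2)) * (norm u)\<^sup>2 \<le> (norm (A *v u))\<^sup>2"
      by (rule order_trans[of _ 0]) auto
    have "(norm (A *v u))\<^sup>2 \<le> (norm u * K)\<^sup>2"
      using K[of u] by (intro power_mono) auto
    also have "\<dots> \<le> (1 + (1 + K\<^sup>2)) * (norm u)\<^sup>2"
      by (simp add: power_mult_distrib algebra_simps)
    finally show "(norm (A *v u))\<^sup>2 \<le> (1 + (1 + K\<^sup>2)) * (norm u)\<^sup>2" .
  qed
  moreover have "0 \<le> d" if d: "ric_bound A s d" for d
  proof -
    define e :: "real ^ 'n" where "e = axis undefined 1"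
    have "supp e = {undefined}" by (auto simp: supp_def e_def axis_def)
    then have "sparse s e" using assms by (simp add: sparse_def)
    then show ?thesis using d unfolding ric_bound_def by (force simp: e_def)
  qed
  moreover have "closed {d. ric_bound A s d}"
    unfolding ric_bound_def
    by (intro closed_Collect_all closed_Collect_imp closed_Collect_conj closed_Collect_le
        continuous_intros) auto
  ultimately show "ric_bound A s (ric A s)" and "ric_bound A s d \<Longrightarrow> ric A s \<le> d"
    using Least_closed_real[of "ric_bound A s"] unfolding ric_def by blast+
qed

lemma roc_least:
  fixes A :: "real ^ 'n ^ 'm"
  shows "roc_bound A s1 s2 (roc A s1 s2)" and "roc_bound A s1 s2 c \<Longrightarrow> roc A s1 s2 \<le> c"
proof -
  obtain K where K: "\<And>u. norm (A *v u) \<le> norm u * K" and "0 < K"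
    using bounded_linear.pos_bounded[of "(*v) A"] matrix_vector_mul_bounded_linear by blast
  have "\<bar>(A *v u) \<bullet> (A *v v)\<bar> \<le> K\<^sup>2 * norm u * norm v" for u v
  proof -
    have "\<bar>(A *v u) \<bullet> (A *v v)\<bar> \<le> norm (A *v u) * norm (A *v v)"
      by (rule Cauchy_Schwarz_ineq2)
    also have "\<dots> \<le> (norm u * K) * (norm v * K)"
      using K \<open>0 < K\<close> by (intro mult_mono) auto
    finally show ?thesis by (simp add: power2_eq_square mult_ac)
  qed
  then have "roc_bound A s1 s2 (K\<^sup>2)" by (simp add: roc_bound_def)
  moreover have "closed {c. roc_bound A s1 s2 c}"
    unfolding roc_bound_def
    by (intro closed_Collect_all closed_Collect_imp closed_Collect_conj closed_Collect_le
        continuous_intros) auto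
  moreover have "0 \<le> c" if "roc_bound A s1 s2 c" for c
    using that by (simp add: roc_bound_def)
  ultimately show "roc_bound A s1 s2 (roc A s1 s2)"
    and "roc_bound A s1 s2 c \<Longrightarrow> roc A s1 s2 \<le> c"
    using Least_closed_real[of "roc_bound A s1 s2"] unfolding roc_def by blast+
qed

end

theory Submission
  imports Defs
begin

text \<open>
  Let \<open>h = xhat - x\<close>. Comparing the objective at \<open>xhat\<close> and \<open>x\<close>, and using subadditivity of
  \<open>\<bar>\<cdot>\<bar> powr p\<close> together with Minkowski's inequality in \<open>l\<^sup>q\<close>, bounds the \<open>p\<close>-mass of \<open>h\<close> off the
  set \<open>T\<close> of its \<open>k\<close> largest entries by its \<open>p\<close>-mass on \<open>T\<close>, the tail of \<open>x\<close> and a multiple of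
  \<open>\<parallel>h\<parallel>\<^sub>q powr p\<close>.  Cut the complement of \<open>T\<close> into blocks of at most \<open>t\<close> entries in decreasing order of
  magnitude and let \<open>X\<close> be the sum of the \<open>l\<^sup>2\<close> norms of \<open>h\<close> on the blocks.  A block with entries
  between \<open>m\<close> and \<open>M\<close> has \<open>l\<^sup>2\<close> norm at most its \<open>l\<^sup>1\<close> norm divided by \<open>sqrt t\<close> plus
  \<open>sqrt t / 4 * (M - m)\<close>, and the second terms telescope, so \<open>X\<close> is controlled by the \<open>l\<^sup>1\<close> norm of
  \<open>h\<close> off \<open>T\<close>.  Since \<open>\<parallel>h\<parallel>\<^sub>q\<close> is in turn bounded by \<open>X\<close> and the \<open>l\<^sup>2\<close> norm \<open>N\<close> of \<open>h\<close> on \<open>T\<close>, solving for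
  \<open>X\<close> (possible as \<open>\<eta> < 1\<close>) gives \<open>X \<le> \<tau> * N + E\<close>, with \<open>E\<close> a multiple of the tail of \<open>x\<close>.  The RIP
  on \<open>T\<close> and the ROP between \<open>T\<close> and each block bound \<open>(1 - \<delta>) * N\<close> by
  \<open>\<theta> * X + 2 * \<epsilon> * sqrt (1 + \<delta>)\<close>, and the two inequalities together bound \<open>N + X\<close>.
\<close>

section \<open>Norms over finite index sets\<close>

text \<open>Convexity is carried over to the endpoint 0, since coordinates may vanish. There the
  inequality reduces to \<open>w powr e <= w\<close> for \<open>0 < w < 1\<close>.\<close>

lemma convex_on_powr_nonneg:
  fixes e :: real
  assumes "1 \<le> e"
  shows "convex_on {0..} (\<lambda>x. x powr e)"
proof (rule convex_onI)
  fix u x y :: real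
  assume u: "0 < u" "u < 1" and xy: "x \<in> {0..}" "y \<in> {0..}"
  have le: "w powr e \<le> w" if "0 < w" "w < 1" for w :: real
    using powr_le_one_le[of w e] that assms by simp
  show "((1 - u) *\<^sub>R x + u *\<^sub>R y) powr e \<le> (1 - u) * x powr e + u * y powr e"
  proof (cases "x = 0 \<or> y = 0")
    case True
    then show ?thesis
      using u le[of u] le[of "1 - u"] by (auto simp: powr_mult intro!: mult_right_mono)
  next
    case False
    then show ?thesis
      using convex_onD[OF powr_convex[OF assms], of u x y] u xy by auto
  qed
qed simp

text \<open>The index type is arbitrary because the inequalities below are also used for families
  indexed by the blocks of a partition, by \<open>bool\<close> and by \<open>{..<3}\<close>.\<close>

definition lp_norm_on :: "real \<Rightarrow> 'a set \<Rightarrow> ('a \<Rightarrow> real) \<Rightarrow> real" where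
  "lp_norm_on r B f = (\<Sum>i\<in>B. \<bar>f i\<bar> powr r) powr (1 / r)"

lemma lp_norm_on_nonneg [simp]: "0 \<le> lp_norm_on r B f"
  by (simp add: lp_norm_on_def)

lemma lp_norm_on_powr:
  assumes "r \<noteq> 0"
  shows "lp_norm_on r B f powr r = (\<Sum>i\<in>B. \<bar>f i\<bar> powr r)"
  using assms by (simp add: lp_norm_on_def powr_powr sum_nonneg)

lemma lp_norm_on_one: "lp_norm_on 1 B f = (\<Sum>i\<in>B. \<bar>f i\<bar>)"
  by (simp add: lp_norm_on_def sum_nonneg)

lemma lp_norm_on_two: "lp_norm_on 2 B f = L2_set f B"
  by (simp add: lp_norm_on_def L2_set_def powr_half_sqrt sum_nonneg)

lemma lp_norm_on_eq_0_iff: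
  assumes "finite B"
  shows "lp_norm_on r B f = 0 \<longleftrightarrow> (\<forall>i\<in>B. f i = 0)"
  using assms by (simp add: lp_norm_on_def sum_nonneg_eq_0_iff)

lemma member_le_lp_norm_on:
  assumes "finite B" "i \<in> B" "0 < r"
  shows "\<bar>f i\<bar> \<le> lp_norm_on r B f"
proof -
  have "(\<bar>f i\<bar> powr r) powr (1 / r) \<le> (\<Sum>i\<in>B. \<bar>f i\<bar> powr r) powr (1 / r)"
    using assms by (intro powr_mono2 member_le_sum) auto
  then show ?thesis
    using assms by (simp add: lp_norm_on_def powr_powr)
qed

text \<open>No entry exceeds \<open>?N\<close>, so each term of the \<open>s\<close>-sum is at most
  \<open>?N powr (s - r)\<close> times the corresponding term of the \<open>r\<close>-sum, and the
  latter add up to \<open>?N powr r\<close>.\<close>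

lemma lp_norm_on_antimono:
  assumes "finite B" "0 < r" "r \<le> s"
  shows "lp_norm_on s B f \<le> lp_norm_on r B f"
proof -
  let ?N = "lp_norm_on r B f"
  have "(\<Sum>i\<in>B. \<bar>f i\<bar> powr s) \<le> (\<Sum>i\<in>B. ?N powr (s - r) * \<bar>f i\<bar> powr r)"
  proof (rule sum_mono)
    fix i assume "i \<in> B"
    have "\<bar>f i\<bar> powr s = \<bar>f i\<bar> powr (s - r) * \<bar>f i\<bar> powr r"
      by (simp flip: powr_add)
    also have "\<dots> \<le> ?N powr (s - r) * \<bar>f i\<bar> powr r"
      using assms \<open>i \<in> B\<close> by (intro mult_right_mono powr_mono2 member_le_lp_norm_on) auto
    finally show "\<bar>f i\<bar> powr s \<le> ?N powr (s - r) * \<bar>f i\<bar> powr r" .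
  qed
  also have "\<dots> = ?N powr (s - r) * ?N powr r"
    using assms by (simp add: sum_distrib_left lp_norm_on_powr)
  also have "\<dots> = ?N powr s"
    by (simp flip: powr_add)
  finally have "lp_norm_on s B f \<le> (?N powr s) powr (1 / s)"
    unfolding lp_norm_on_def[of s] using assms by (intro powr_mono2 sum_nonneg) auto
  then show ?thesis
    using assms by (simp add: powr_powr)
qed

text \<open>Jensen's inequality for \<open>x powr (s / r)\<close> with equal weights. As the
  exponent is nonnegative, \<open>card B\<close> may be enlarged to \<open>c\<close>, so that blocks
  of different sizes share one constant.\<close>

lemma lp_norm_on_power_mean:
  assumes "finite B" "0 < r" "r \<le> s" "real (card B) \<le> c"
  shows "lp_norm_on r B f \<le> c powr (1 / r - 1 / s) * lp_norm_on s B f"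
proof (cases "B = {}")
  case True
  then show ?thesis by (simp add: lp_norm_on_def)
next
  case False
  define m where "m = real (card B)"
  define e where "e = s / r"
  let ?R = "\<Sum>i\<in>B. \<bar>f i\<bar> powr r" and ?S = "\<Sum>i\<in>B. \<bar>f i\<bar> powr s"
  have m: "0 < m" using False assms by (simp add: m_def card_gt_0_iff)
  have e: "1 \<le> e" using assms by (simp add: e_def)
  have "(\<Sum>i\<in>B. (1 / m) *\<^sub>R \<bar>f i\<bar> powr r) powr e \<le> (\<Sum>i\<in>B. (1 / m) * (\<bar>f i\<bar> powr r) powr e)"
    using False assms m
    by (intro convex_on_sum[OF _ _ convex_on_powr_nonneg[OF e]]) (auto simp: m_def)
  moreover have "(\<Sum>i\<in>B. (1 / m) *\<^sub>R \<bar>f i\<bar> powr r) = ?R / m"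
    by (simp add: sum_divide_distrib)
  moreover have "(\<Sum>i\<in>B. (1 / m) * (\<bar>f i\<bar> powr r) powr e) = ?S / m"
    using assms by (simp add: sum_divide_distrib powr_powr e_def)
  ultimately have "?R powr e / m powr e \<le> ?S / m"
    by (simp add: powr_divide)
  then have "?R powr e \<le> m powr (e - 1) * ?S"
    using m by (simp add: field_simps powr_diff)
  then have "(?R powr e) powr (1 / s) \<le> (m powr (e - 1) * ?S) powr (1 / s)"
    using assms by (intro powr_mono2) auto
  also have "\<dots> = m powr ((e - 1) / s) * lp_norm_on s B f"
    by (simp add: powr_mult powr_powr lp_norm_on_def)
  also have "(e - 1) / s = 1 / r - 1 / s"
    using assms by (simp add: e_def field_simps)
  also have "(?R powr e) powr (1 / s) = lp_norm_on r B f"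
    using assms by (simp add: lp_norm_on_def powr_powr e_def)
  also have "m powr (1 / r - 1 / s) \<le> c powr (1 / r - 1 / s)"
    using assms m by (intro powr_mono2) (auto simp: m_def field_simps)
  finally show ?thesis
    by (simp add: mult_right_mono)
qed

text \<open>The two cases are the origin of the maximum in \<open>vtheta\<close>: up to exponent 2
  the power mean costs a factor, beyond 2 the norms decrease and the factor is
  \<open>c powr 0 = 1\<close>.\<close>

lemma lp_norm_on_le_L2_set:
  assumes "finite B" "0 < r" "card B \<le> c" "1 \<le> c"
  shows "lp_norm_on r B f \<le> real c powr max (1 / r - 1 / 2) 0 * L2_set f B"
proof (cases "r \<le> 2")
  case True
  then have "max (1 / r - 1 / 2) 0 = 1 / r - 1 / 2"
    using assms by (simp add: field_simps)
  then show ?thesis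
    using lp_norm_on_power_mean[of B r 2 c f] True assms by (simp add: lp_norm_on_two)
next
  case False
  then have "max (1 / r - 1 / 2) 0 = 0"
    by (simp add: field_simps)
  then show ?thesis
    using lp_norm_on_antimono[of B 2 r f] False assms by (simp add: lp_norm_on_two)
qed

text \<open>Antimonotonicity of the norms in the exponent, applied to the pair \<open>u\<close>,
  \<open>v\<close> indexed by \<open>bool\<close>.\<close>

lemma powr_add_le_powr_add_powr:
  fixes u v p :: real
  assumes "0 \<le> u" "0 \<le> v" "0 < p" "p \<le> 1"
  shows "(u + v) powr p \<le> u powr p + v powr p"
proof -
  define f where "f = (\<lambda>b. if b then u else v)"
  have "lp_norm_on 1 UNIV f powr p \<le> lp_norm_on p UNIV f powr p"
    using assms by (intro powr_mono2 lp_norm_on_antimono) auto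
  then show ?thesis
    using assms by (simp add: lp_norm_on_powr lp_norm_on_one f_def UNIV_bool add.commute)
qed

text \<open>Minkowski's inequality by convexity alone: once \<open>f\<close> and \<open>g\<close>
  are scaled to norm 1, their sum divided by \<open>u + v\<close> is a convex combination with
  weights \<open>1 - w\<close> and \<open>w\<close>. Zero norms are split off because of the
  divisions.\<close>

lemma lp_norm_on_triangle:
  assumes "finite B" "1 \<le> r"
  shows "lp_norm_on r B (\<lambda>i. f i + g i) \<le> lp_norm_on r B f + lp_norm_on r B g"
proof -
  define u v where "u = lp_norm_on r B f" and "v = lp_norm_on r B g"
  have nn: "0 \<le> u" "0 \<le> v" by (simp_all add: u_def v_def)
  consider "u = 0" | "v = 0" | "0 < u" "0 < v" using nn by fastforce
  then show ?thesis
  proof cases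
    case 1
    then have "f i = 0" if "i \<in> B" for i
      using that assms by (simp add: u_def lp_norm_on_eq_0_iff)
    then have "lp_norm_on r B (\<lambda>i. f i + g i) = v"
      by (simp add: v_def lp_norm_on_def)
    then show ?thesis by (simp add: v_def)
  next
    case 2
    then have "g i = 0" if "i \<in> B" for i
      using that assms by (simp add: v_def lp_norm_on_eq_0_iff)
    then have "lp_norm_on r B (\<lambda>i. f i + g i) = u"
      by (simp add: u_def lp_norm_on_def)
    then show ?thesis by (simp add: u_def)
  next
    case 3
    define w where "w = v / (u + v)"
    have w: "0 \<le> w" "w \<le> 1" and w1: "1 - w = u / (u + v)"
      using 3 by (simp_all add: w_def field_simps)
    have F: "(\<Sum>i\<in>B. (\<bar>f i\<bar> / u) powr r) = 1"
      using 3 assms lp_norm_on_powr[of r B f, folded u_def]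
      by (simp add: powr_divide flip: sum_divide_distrib) (metis powr_eq_0_iff less_irrefl)
    have G: "(\<Sum>i\<in>B. (\<bar>g i\<bar> / v) powr r) = 1"
      using 3 assms lp_norm_on_powr[of r B g, folded v_def]
      by (simp add: powr_divide flip: sum_divide_distrib) (metis powr_eq_0_iff less_irrefl)
    have "(\<Sum>i\<in>B. (\<bar>f i + g i\<bar> / (u + v)) powr r)
        \<le> (\<Sum>i\<in>B. (1 - w) * (\<bar>f i\<bar> / u) powr r + w * (\<bar>g i\<bar> / v) powr r)"
    proof (rule sum_mono)
      fix i
      have "\<bar>f i + g i\<bar> / (u + v) \<le> (\<bar>f i\<bar> + \<bar>g i\<bar>) / (u + v)"
        using nn by (intro divide_right_mono) auto
      also have "\<dots> = (1 - w) *\<^sub>R (\<bar>f i\<bar> / u) + w *\<^sub>R (\<bar>g i\<bar> / v)"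
        using 3 unfolding w1 by (simp add: w_def add_divide_distrib)
      finally have "(\<bar>f i + g i\<bar> / (u + v)) powr r
          \<le> ((1 - w) *\<^sub>R (\<bar>f i\<bar> / u) + w *\<^sub>R (\<bar>g i\<bar> / v)) powr r"
        using 3 assms by (intro powr_mono2) auto
      also have "\<dots> \<le> (1 - w) * (\<bar>f i\<bar> / u) powr r + w * (\<bar>g i\<bar> / v) powr r"
        using convex_onD[OF convex_on_powr_nonneg[OF assms(2)] w(1) w(2),
            of "\<bar>f i\<bar> / u" "\<bar>g i\<bar> / v"] nn
        by simp
      finally show "(\<bar>f i + g i\<bar> / (u + v)) powr r
          \<le> (1 - w) * (\<bar>f i\<bar> / u) powr r + w * (\<bar>g i\<bar> / v) powr r" .
    qed
    also have "\<dots> = 1"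
      by (simp add: sum.distrib F G flip: sum_distrib_left)
    finally have "lp_norm_on r B (\<lambda>i. f i + g i) powr r \<le> (u + v) powr r"
      using 3 assms by (simp add: powr_divide lp_norm_on_powr flip: sum_divide_distrib)
    then have "(lp_norm_on r B (\<lambda>i. f i + g i) powr r) powr (1 / r) \<le> ((u + v) powr r) powr (1 / r)"
      using assms by (intro powr_mono2[of "1 / r"]) auto
    then show ?thesis
      using 3 assms by (simp add: powr_powr u_def v_def)
  qed
qed

text \<open>The \<open>r\<close>-th powers add up over the blocks, so the left side is the
  \<open>r\<close>-norm of the family of block norms, which is at most its 1-norm.\<close>

lemma lp_norm_on_le_sum_partition:
  assumes "finite D" "partition_on D P" "1 \<le> r"
  shows "lp_norm_on r D f \<le> (\<Sum>B\<in>P. lp_norm_on r B f)"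
proof -
  have P: "finite P" using assms finite_elements by blast
  have "(\<Sum>i\<in>D. \<bar>f i\<bar> powr r) = (\<Sum>B\<in>P. \<Sum>i\<in>B. \<bar>f i\<bar> powr r)"
    using assms sum.Union_disjoint_sets[of P] partition_onD1[OF assms(2)] partition_onD2[OF assms(2)]
    by (metis (no_types, lifting) Sup_upper finite_subset comp_apply sum.cong)
  also have "\<dots> = (\<Sum>B\<in>P. \<bar>lp_norm_on r B f\<bar> powr r)"
    using assms by (simp add: lp_norm_on_powr)
  finally have "lp_norm_on r D f = lp_norm_on r P (\<lambda>B. lp_norm_on r B f)"
    by (simp only: lp_norm_on_def[of _ D] lp_norm_on_def[of _ P])
  also have "\<dots> \<le> lp_norm_on 1 P (\<lambda>B. lp_norm_on r B f)"
    using assms P by (intro lp_norm_on_antimono) auto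
  finally show ?thesis by (simp add: lp_norm_on_one)
qed

text \<open>Source of the constant \<open>a\<close>: the power mean inequality between the exponents
  \<open>p\<close> and 1 on three entries.\<close>

lemma powr_inverse_sum3_le:
  fixes u v w p :: real
  assumes "0 \<le> u" "0 \<le> v" "0 \<le> w" "0 < p" "p \<le> 1"
  shows "(u powr p + v powr p + w powr p) powr (1 / p) \<le> 3 powr ((1 - p) / p) * (u + v + w)"
proof -
  define f where "f = (\<lambda>i::nat. if i = 0 then u else if i = 1 then v else w)"
  have "lp_norm_on p {..<3} f \<le> 3 powr (1 / p - 1 / 1) * lp_norm_on 1 {..<3} f"
    using assms by (intro lp_norm_on_power_mean) auto
  moreover have "1 / p - 1 / 1 = (1 - p) / p"
    using assms by (simp add: field_simps)
  ultimately show ?thesis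
    using assms unfolding lp_norm_on_one
    by (simp add: lp_norm_on_def f_def numeral_3_eq_3 lessThan_Suc add_ac)
qed

section \<open>Decreasing rearrangement into blocks\<close>

lemma ex_top_subset:
  fixes f :: "'a \<Rightarrow> real"
  assumes "finite D" "t \<le> card D"
  shows "\<exists>B \<subseteq> D. card B = t \<and> (\<forall>i\<in>B. \<forall>j\<in>D - B. f j \<le> f i)"
  using assms(2)
proof (induction t)
  case 0
  show ?case by (rule exI[of _ "{}"]) simp
next
  case (Suc t)
  then obtain B where B: "B \<subseteq> D" "card B = t" "\<forall>i\<in>B. \<forall>j\<in>D - B. f j \<le> f i"
    by auto
  have fin: "finite B" using B assms finite_subset by blast
  have ne: "D - B \<noteq> {}"
    using B Suc.prems fin by (metis Diff_eq_empty_iff card_mono Suc_n_not_le_n order_trans)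
  have "Max (f ` (D - B)) \<in> f ` (D - B)"
    using ne assms by (intro Max_in) auto
  then obtain d where d: "d \<in> D - B" "f d = Max (f ` (D - B))" by auto
  have "f j \<le> f d" if "j \<in> D - B" for j
    using that assms unfolding d(2) by (intro Max_ge) auto
  then show ?case
    using B d fin by (intro exI[of _ "insert d B"]) auto
qed

text \<open>The elements of \<open>S - T\<close> are exchanged bijectively for those of
  \<open>T - S\<close>, where \<open>f\<close> is at least as large.\<close>

lemma sum_le_sum_top:
  fixes f :: "'a::finite \<Rightarrow> real"
  assumes "card S = card T" "\<And>i j. i \<in> T \<Longrightarrow> j \<notin> T \<Longrightarrow> f j \<le> f i"
  shows "sum f S \<le> sum f T"
proof -
  have "card (S - T) = card (T - S)"
    using assms(1) by (metis card_le_sym_Diff finite le_antisym nle_le)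
  then obtain g where g: "bij_betw g (S - T) (T - S)"
    using finite_same_card_bij[of "S - T" "T - S"] by auto
  have "sum f (S - T) \<le> (\<Sum>i\<in>S - T. f (g i))"
    using g assms(2) by (intro sum_mono) (auto dest: bij_betwE)
  also have "\<dots> = sum f (T - S)"
    using sum.reindex_bij_betw[OF g] .
  finally have "sum f (S - T) \<le> sum f (T - S)" .
  moreover have "sum f S = sum f (S \<inter> T) + sum f (S - T)" "sum f T = sum f (S \<inter> T) + sum f (T - S)"
    by (simp_all add: sum.Int_Diff Int_commute sum.Int_Diff[of T f S])
  ultimately show ?thesis by simp
qed

text \<open>A block with fewer than \<open>t\<close> entries is to be thought of as padded with zeros, so that its
  smallest entry is \<open>m = 0\<close>.\<close>

lemma L2_set_le_block:
  fixes f :: "'a \<Rightarrow> real"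
  assumes t: "0 < t" and card: "card B = t \<or> card B \<le> t \<and> m = 0"
    and m: "0 \<le> m" "m \<le> M" and f: "\<And>i. i \<in> B \<Longrightarrow> m \<le> \<bar>f i\<bar> \<and> \<bar>f i\<bar> \<le> M"
  shows "L2_set f B \<le> (\<Sum>i\<in>B. \<bar>f i\<bar>) / sqrt t + sqrt t / 4 * (M - m)"
proof -
  let ?s = "\<Sum>i\<in>B. \<bar>f i\<bar>"
  define r where "r = sqrt (real t)"
  have r: "0 < r" "r\<^sup>2 = real t" using t by (auto simp: r_def)
  \<comment> \<open>Each magnitude lies between \<open>m\<close> and \<open>M\<close>, so its square
    is at most a linear function of it.\<close>
  have "(\<Sum>i\<in>B. (f i)\<^sup>2) \<le> (\<Sum>i\<in>B. (M + m) * \<bar>f i\<bar> - M * m)"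
  proof (rule sum_mono)
    fix i assume "i \<in> B"
    then have "0 \<le> (\<bar>f i\<bar> - m) * (M - \<bar>f i\<bar>)" using f by simp
    also have "\<dots> = (M + m) * \<bar>f i\<bar> - M * m - (f i)\<^sup>2"
      by (simp add: algebra_simps flip: power2_eq_square)
    finally show "(f i)\<^sup>2 \<le> (M + m) * \<bar>f i\<bar> - M * m" by simp
  qed
  \<comment> \<open>For a short block \<open>m = 0\<close>, so the constant term vanishes whatever
    the cardinality.\<close>
  also have "\<dots> = (M + m) * ?s - r\<^sup>2 * (M * m)"
    using card r(2) by (auto simp: sum_subtractf simp flip: sum_distrib_left)
  also have "\<dots> \<le> (?s / r + r / 4 * (M - m))\<^sup>2"
  proof -
    \<comment> \<open>Completing the square in \<open>?s\<close>. The case \<open>m = 0 < M\<close>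
      explains the constant 1/4: no smaller one keeps the quadratic nonnegative for all
      \<open>?s >= 0\<close>.\<close>
    have "(?s / r + r / 4 * (M - m))\<^sup>2 - ((M + m) * ?s - r\<^sup>2 * (M * m))
        = (?s / r - r * (M + 3 * m) / 4)\<^sup>2 + r\<^sup>2 * (m * (M - m)) / 2"
      using r(1) by (simp add: field_simps power2_eq_square)
    also have "\<dots> \<ge> 0" using m by simp
    finally show ?thesis by simp
  qed
  finally show ?thesis
    unfolding L2_set_def r_def[symmetric] using m r
    by (intro real_le_lsqrt) (auto simp: sum_nonneg)
qed

text \<open>Induction on \<open>card D\<close>, splitting off the \<open>t\<close> largest
  magnitudes. The smallest magnitude \<open>m\<close> of the new block bounds all that is left and
  takes the role of \<open>M\<close> there, so that \<open>M - m\<close> and \<open>m\<close> add up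
  to \<open>M\<close>.\<close>

lemma block_decomposition:
  fixes f :: "'a \<Rightarrow> real"
  assumes "finite D" and t: "0 < t" and "0 \<le> M" "\<And>i. i \<in> D \<Longrightarrow> \<bar>f i\<bar> \<le> M"
  shows "\<exists>P. partition_on D P \<and> (\<forall>B\<in>P. card B \<le> t) \<and>
           (\<Sum>B\<in>P. L2_set f B) \<le> (\<Sum>i\<in>D. \<bar>f i\<bar>) / sqrt t + sqrt t / 4 * M"
  using assms(1,3,4)
proof (induction "card D" arbitrary: D M rule: less_induct)
  case less
  show ?case
  proof (cases "D = {}")
    case True
    then show ?thesis using less.prems by (intro exI[of _ "{}"]) (simp add: partition_on_empty)
  next
    case ne: False
    show ?thesis
    proof (cases "card D \<le> t")
      case True
      \<comment> \<open>The last, possibly short block gets the lower bound 0.\<close>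
      then have "L2_set f D \<le> (\<Sum>i\<in>D. \<bar>f i\<bar>) / sqrt t + sqrt t / 4 * (M - 0)"
        using less.prems t by (intro L2_set_le_block) auto
      then show ?thesis
        using True ne by (intro exI[of _ "{D}"]) (simp add: partition_on_space)
    next
      case False
      then obtain B where B: "B \<subseteq> D" "card B = t" "\<forall>i\<in>B. \<forall>j\<in>D - B. \<bar>f j\<bar> \<le> \<bar>f i\<bar>"
        using ex_top_subset[of D t "\<lambda>i. \<bar>f i\<bar>"] less.prems by auto
      have finB: "finite B" and Bne: "B \<noteq> {}"
        using B t less.prems finite_subset by auto
      define m where "m = Min ((\<lambda>i. \<bar>f i\<bar>) ` B)"
      have "m \<in> (\<lambda>i. \<bar>f i\<bar>) ` B" unfolding m_def using finB Bne by (intro Min_in) auto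
      then obtain i0 where i0: "i0 \<in> B" "m = \<bar>f i0\<bar>" by auto
      have m_le: "m \<le> \<bar>f i\<bar>" if "i \<in> B" for i
        unfolding m_def using that finB by (intro Min_le) auto
      have block: "L2_set f B \<le> (\<Sum>i\<in>B. \<bar>f i\<bar>) / sqrt t + sqrt t / 4 * (M - m)"
        using B i0 m_le less.prems t by (intro L2_set_le_block) auto
      have "\<exists>P. partition_on (D - B) P \<and> (\<forall>B\<in>P. card B \<le> t) \<and>
           (\<Sum>B\<in>P. L2_set f B) \<le> (\<Sum>i\<in>D - B. \<bar>f i\<bar>) / sqrt t + sqrt t / 4 * m"
      proof (rule less.hyps)
        show "card (D - B) < card D"
          using B finB Bne less.prems by (intro psubset_card_mono) auto
      qed (use less.prems B i0 in auto)
      then obtain P where P: "partition_on (D - B) P" "\<forall>B\<in>P. card B \<le> t"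
        "(\<Sum>B\<in>P. L2_set f B) \<le> (\<Sum>i\<in>D - B. \<bar>f i\<bar>) / sqrt t + sqrt t / 4 * m"
        by blast
      have BP: "B \<notin> P" and disj: "disjnt B (\<Union>P)"
        using P(1) Bne unfolding partition_on_def disjnt_def by blast+
      have finP: "finite P" using P(1) less.prems finite_elements by blast
      have "(\<Sum>C\<in>insert B P. L2_set f C) = L2_set f B + (\<Sum>C\<in>P. L2_set f C)"
        using BP finP by simp
      also have "\<dots> \<le> ((\<Sum>i\<in>B. \<bar>f i\<bar>) + (\<Sum>i\<in>D - B. \<bar>f i\<bar>)) / sqrt t + sqrt t / 4 * M"
        using block P(3) by (simp add: add_divide_distrib right_diff_distrib)
      also have "(\<Sum>i\<in>B. \<bar>f i\<bar>) + (\<Sum>i\<in>D - B. \<bar>f i\<bar>) = (\<Sum>i\<in>D. \<bar>f i\<bar>)"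
        using B less.prems by (simp add: sum.subset_diff add.commute)
      finally show ?thesis
        using P B Bne by (intro exI[of _ "insert B P"]) (simp add: partition_on_insert[OF disj])
    qed
  qed
qed

section \<open>The recovery bound\<close>

lemma lp_norm_eq_lp_norm_on: "lp_norm r u = lp_norm_on r UNIV (($) u)"
  by (simp add: lp_norm_def lp_norm_on_def)

lemma norm_eq_lp_norm_on: "norm u = lp_norm_on 2 UNIV (($) u)" for u :: "real ^ 'n"
  by (simp add: lp_norm_on_two norm_vec_def L2_set_def)

lemma lp_norm_pos_iff: "0 < lp_norm r u \<longleftrightarrow> u \<noteq> 0"
  using lp_norm_on_eq_0_iff[of UNIV r "($) u"] lp_norm_on_nonneg[of r UNIV "($) u"]
  by (auto simp: lp_norm_eq_lp_norm_on vec_eq_iff less_le)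

section \<open>Restriction of vectors to index sets\<close>

definition vec_restrict :: "'n set \<Rightarrow> real ^ 'n \<Rightarrow> real ^ 'n" where
  "vec_restrict B u = (\<chi> i. if i \<in> B then u $ i else 0)"

lemma vec_restrict_nth [simp]: "vec_restrict B u $ i = (if i \<in> B then u $ i else 0)"
  by (simp add: vec_restrict_def)

lemma supp_vec_restrict: "supp (vec_restrict B u) \<subseteq> B"
  by (auto simp: supp_def)

lemma sparse_vec_restrict: "card B \<le> s \<Longrightarrow> sparse s (vec_restrict B u)"
  unfolding sparse_def using card_mono[OF finite supp_vec_restrict] by (rule order_trans)

lemma norm_vec_restrict: "norm (vec_restrict B u) = L2_set (($) u) B"
proof -
  have "(\<Sum>i\<in>UNIV. (vec_restrict B u $ i)\<^sup>2) = (\<Sum>i\<in>B. (u $ i)\<^sup>2)"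
    by (intro sum.mono_neutral_cong_right) auto
  then show ?thesis by (simp add: norm_vec_def L2_set_def)
qed

lemma sum_vec_restrict_partition:
  assumes "partition_on D P"
  shows "(\<Sum>B\<in>P. vec_restrict B u) = vec_restrict D u"
proof (rule vec_eq_iff[THEN iffD2], rule allI)
  fix i
  have "(\<Sum>B\<in>P. vec_restrict B u $ i) = vec_restrict D u $ i"
  proof (cases "i \<in> D")
    case True
    then obtain C where C: "C \<in> P" "i \<in> C"
      using assms by (auto simp: partition_on_def)
    have "(\<Sum>B\<in>P. vec_restrict B u $ i) = (\<Sum>B\<in>P. if B = C then u $ i else 0)"
      using C assms by (intro sum.cong) (auto simp: partition_on_def disjoint_def)
    then show ?thesis using C True by simp
  next
    case False
    then show ?thesis using assms by (auto simp: partition_on_def intro!: sum.neutral)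
  qed
  then show "(\<Sum>B\<in>P. vec_restrict B u) $ i = vec_restrict D u $ i" by simp
qed

lemma vec_restrict_add_Compl: "vec_restrict T u + vec_restrict (- T) u = u"
  by (simp add: vec_eq_iff)

text \<open>Multiply \<open>opt\<close> by \<open>lp_norm q (x + h) powr p\<close>. The share of
  \<open>x\<close> in this factor, times \<open>R\<close>, returns exactly
  \<open>lp_norm p x powr p\<close>, so only the share of \<open>h\<close> has to be estimated
  through \<open>\<beta>\<close>.\<close>

lemma cone_constraint:
  fixes x h :: "real ^ 'n"
  assumes p: "0 < p" "p \<le> 1" and q: "1 < q" and "x \<noteq> 0" "x + h \<noteq> 0"
    and ratio: "lp_norm p x / lp_norm q x \<le> \<beta>"
    and opt: "lp_norm p (x + h) powr p / lp_norm q (x + h) powr p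
                \<le> lp_norm p x powr p / lp_norm q x powr p"
  shows "(\<Sum>i\<in>- S. \<bar>h $ i\<bar> powr p)
           \<le> (\<Sum>i\<in>S. \<bar>h $ i\<bar> powr p) + 2 * (\<Sum>i\<in>- S. \<bar>x $ i\<bar> powr p) + \<beta> powr p * lp_norm q h powr p"
proof -
  define R where "R = lp_norm p x powr p / lp_norm q x powr p"
  have pos: "0 < lp_norm q x" "0 < lp_norm q (x + h)"
    using assms by (simp_all add: lp_norm_pos_iff)
  have nn: "0 \<le> lp_norm q h" "0 \<le> R"
    by (simp_all add: lp_norm_eq_lp_norm_on R_def)
  have "R = (lp_norm p x / lp_norm q x) powr p"
    by (simp add: R_def powr_divide)
  also have "\<dots> \<le> \<beta> powr p"
    using ratio p by (intro powr_mono2) (auto simp: lp_norm_eq_lp_norm_on)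
  finally have R: "R \<le> \<beta> powr p" .
  have sum_p: "lp_norm p u powr p = (\<Sum>i\<in>UNIV. \<bar>u $ i\<bar> powr p)" for u :: "real ^ 'n"
    using p by (simp add: lp_norm_eq_lp_norm_on lp_norm_on_powr)
  have split: "(\<Sum>i\<in>UNIV. g i) = (\<Sum>i\<in>S. g i) + (\<Sum>i\<in>- S. g i)" for g :: "'n \<Rightarrow> real"
    by (simp add: Compl_eq_Diff_UNIV sum.subset_diff[of S UNIV])
  have tri: "\<bar>v + w\<bar> powr p \<le> \<bar>v\<bar> powr p + \<bar>w\<bar> powr p" for v w :: real
  proof -
    have "\<bar>v + w\<bar> powr p \<le> (\<bar>v\<bar> + \<bar>w\<bar>) powr p" using p by (intro powr_mono2) auto
    also have "\<dots> \<le> \<bar>v\<bar> powr p + \<bar>w\<bar> powr p" using p by (intro powr_add_le_powr_add_powr) auto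
    finally show ?thesis .
  qed
  have "lp_norm q (x + h) \<le> lp_norm q x + lp_norm q h"
    using lp_norm_on_triangle[of UNIV q "($) x" "($) h"] q by (simp add: lp_norm_eq_lp_norm_on lp_norm_on_def)
  then have "lp_norm q (x + h) powr p \<le> (lp_norm q x + lp_norm q h) powr p"
    using p pos by (intro powr_mono2) auto
  also have "\<dots> \<le> lp_norm q x powr p + lp_norm q h powr p"
    using p pos nn by (intro powr_add_le_powr_add_powr) auto
  finally have q_le: "lp_norm q (x + h) powr p \<le> lp_norm q x powr p + lp_norm q h powr p" .
  have "lp_norm p (x + h) powr p \<le> R * lp_norm q (x + h) powr p"
    using opt pos by (simp add: R_def pos_divide_le_eq)
  also have "\<dots> \<le> R * (lp_norm q x powr p + lp_norm q h powr p)"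
    using q_le nn(2) by (rule mult_left_mono)
  also have "\<dots> = lp_norm p x powr p + R * lp_norm q h powr p"
    using pos by (simp add: R_def distrib_left)
  also have "\<dots> \<le> lp_norm p x powr p + \<beta> powr p * lp_norm q h powr p"
    using R by (simp add: mult_right_mono)
  finally have main: "(\<Sum>i\<in>UNIV. \<bar>(x + h) $ i\<bar> powr p)
      \<le> (\<Sum>i\<in>UNIV. \<bar>x $ i\<bar> powr p) + \<beta> powr p * lp_norm q h powr p"
    by (simp only: sum_p)
  \<comment> \<open>On \<open>S\<close> the triangle inequality isolates \<open>x\<close>, off
    \<open>S\<close> it isolates \<open>h\<close>. The tail of \<open>x\<close> thus occurs once in
    \<open>main\<close> and once here, whence the factor 2.\<close>
  have "(\<Sum>i\<in>S. \<bar>x $ i\<bar> powr p) \<le> (\<Sum>i\<in>S. \<bar>(x + h) $ i\<bar> powr p + \<bar>h $ i\<bar> powr p)"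
    using tri[of "(x + h) $ i" "- h $ i" for i] by (intro sum_mono) simp
  moreover have "(\<Sum>i\<in>- S. \<bar>h $ i\<bar> powr p) \<le> (\<Sum>i\<in>- S. \<bar>(x + h) $ i\<bar> powr p + \<bar>x $ i\<bar> powr p)"
    using tri[of "(x + h) $ i" "- x $ i" for i] by (intro sum_mono) simp
  ultimately show ?thesis
    using main by (simp only: split sum.distrib)
qed

text \<open>Expand \<open>A *v h\<close> over \<open>T\<close> and the blocks and take the inner
  product with \<open>A *v hT\<close>. RIP bounds the square of \<open>A *v hT\<close> from below,
  ROP bounds the cross terms, and Cauchy-Schwarz the product with \<open>A *v h\<close>. A common
  factor \<open>N\<close> cancels.\<close>

lemma rip_rop_bound:
  fixes A :: "real ^ 'n ^ 'm" and h :: "real ^ 'n"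
  assumes rip: "ric_bound A k \<delta>" and rop: "roc_bound A k t \<theta>" and \<delta>: "0 \<le> \<delta>"
    and T: "card T = k" and P: "partition_on (- T) P" "\<And>B. B \<in> P \<Longrightarrow> card B \<le> t"
    and small: "norm (A *v h) \<le> e"
  shows "(1 - \<delta>) * L2_set (($) h) T \<le> \<theta> * (\<Sum>B\<in>P. L2_set (($) h) B) + e * sqrt (1 + \<delta>)"
proof (cases "L2_set (($) h) T = 0")
  \<comment> \<open>Without a nonzero \<open>N\<close> to cancel, it suffices that the right side is
    nonnegative.\<close>
  case True
  have "0 \<le> e" using small norm_ge_zero order_trans by blast
  moreover have "0 \<le> \<theta>" using rop by (simp add: roc_bound_def)
  ultimately show ?thesis using True \<delta> by (simp add: sum_nonneg)
next
  case False
  define hT where "hT = vec_restrict T h"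
  define N where "N = norm hT"
  have N: "N = L2_set (($) h) T" by (simp add: N_def hT_def norm_vec_restrict)
  have Npos: "0 < N" using False N by (simp add: less_le)
  have sp: "sparse k hT" using T by (simp add: hT_def sparse_vec_restrict)
  have lower: "(1 - \<delta>) * N\<^sup>2 \<le> (norm (A *v hT))\<^sup>2" and "(norm (A *v hT))\<^sup>2 \<le> (1 + \<delta>) * N\<^sup>2"
    using rip sp by (auto simp: ric_bound_def N_def)
  then have upper: "norm (A *v hT) \<le> sqrt (1 + \<delta>) * N"
    using Npos real_le_rsqrt by (fastforce simp: real_sqrt_mult)
  have "h = hT + (\<Sum>B\<in>P. vec_restrict B h)"
    using sum_vec_restrict_partition[OF P(1)] by (simp add: hT_def vec_restrict_add_Compl)
  then have "A *v h = A *v hT + (\<Sum>B\<in>P. A *v vec_restrict B h)"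
    by (metis matrix_vector_right_distrib linear_sum[OF matrix_vector_mul_linear])
  then have "(norm (A *v hT))\<^sup>2 = (A *v hT) \<bullet> (A *v h) - (\<Sum>B\<in>P. (A *v hT) \<bullet> (A *v vec_restrict B h))"
    by (simp add: inner_add_right inner_sum_right power2_norm_eq_inner)
  moreover have "(A *v hT) \<bullet> (A *v h) \<le> (sqrt (1 + \<delta>) * N) * e"
    using norm_cauchy_schwarz upper small \<delta> Npos
    by (meson mult_mono mult_nonneg_nonneg norm_ge_zero order_trans)
  moreover have "\<bar>\<Sum>B\<in>P. (A *v hT) \<bullet> (A *v vec_restrict B h)\<bar> \<le> (\<Sum>B\<in>P. \<theta> * N * L2_set (($) h) B)"
  proof (rule order_trans[OF sum_abs], rule sum_mono)
    fix B assume B: "B \<in> P"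
    then have "B \<inter> T = {}" using P(1) by (auto simp: partition_on_def)
    then have "supp hT \<inter> supp (vec_restrict B h) = {}"
      using supp_vec_restrict unfolding hT_def by blast
    then show "\<bar>(A *v hT) \<bullet> (A *v vec_restrict B h)\<bar> \<le> \<theta> * N * L2_set (($) h) B"
      using rop sp sparse_vec_restrict[OF P(2)[OF B]]
      unfolding roc_bound_def N_def norm_vec_restrict[symmetric] by blast
  qed
  ultimately have "(1 - \<delta>) * N\<^sup>2 \<le> sqrt (1 + \<delta>) * N * e + \<theta> * N * (\<Sum>B\<in>P. L2_set (($) h) B)"
    using lower by (simp add: sum_distrib_left)
  then have "((1 - \<delta>) * N) * N \<le> (\<theta> * (\<Sum>B\<in>P. L2_set (($) h) B) + e * sqrt (1 + \<delta>)) * N"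
    by (simp add: algebra_simps power2_eq_square)
  then show ?thesis using Npos N by simp
qed

text \<open>The entries off \<open>T\<close> are at most the \<open>p\<close>-mean of those on \<open>T\<close>; taking \<open>G\<close> above both
  masses avoids having to know which of the two is larger.\<close>

lemma l1_tail_le:
  fixes h :: "'a::finite \<Rightarrow> real"
  assumes p: "0 < p" "p \<le> 1" and k: "card T = k" "1 \<le> k"
    and M: "0 \<le> M" "\<And>i. i \<in> T \<Longrightarrow> M \<le> \<bar>h i\<bar>" "\<And>j. j \<notin> T \<Longrightarrow> \<bar>h j\<bar> \<le> M"
    and G: "(\<Sum>i\<in>T. \<bar>h i\<bar> powr p) \<le> G" "(\<Sum>i\<in>- T. \<bar>h i\<bar> powr p) \<le> G"
  shows "(\<Sum>i\<in>- T. \<bar>h i\<bar>) \<le> real k powr ((p - 1) / p) * G powr (1 / p)"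
proof -
  have G0: "0 \<le> G" using G(1) sum_nonneg[of T "\<lambda>i. \<bar>h i\<bar> powr p"] by simp
  have "real k * M powr p \<le> (\<Sum>i\<in>T. \<bar>h i\<bar> powr p)"
    using sum_mono[of T "\<lambda>_. M powr p" "\<lambda>i. \<bar>h i\<bar> powr p"] M k p by (simp add: powr_mono2)
  then have "M powr p \<le> G / k" using G(1) k by (simp add: field_simps)
  then have "(M powr p) powr ((1 - p) / p) \<le> (G / k) powr ((1 - p) / p)"
    using p by (intro powr_mono2) auto
  then have M_le: "M powr (1 - p) \<le> (G / k) powr ((1 - p) / p)"
    using p by (simp add: powr_powr)
  \<comment> \<open>A factor of exponent \<open>1 - p\<close> is bounded through \<open>M\<close>,
    and the remaining \<open>p\<close>-mass through \<open>G\<close>.\<close>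
  have "(\<Sum>i\<in>- T. \<bar>h i\<bar>) \<le> (\<Sum>i\<in>- T. M powr (1 - p) * \<bar>h i\<bar> powr p)"
  proof (rule sum_mono)
    fix i assume "i \<in> - T"
    have "\<bar>h i\<bar> = \<bar>h i\<bar> powr (1 - p) * \<bar>h i\<bar> powr p" by (simp flip: powr_add)
    also have "\<dots> \<le> M powr (1 - p) * \<bar>h i\<bar> powr p"
      using \<open>i \<in> - T\<close> M p by (intro mult_right_mono powr_mono2) auto
    finally show "\<bar>h i\<bar> \<le> M powr (1 - p) * \<bar>h i\<bar> powr p" .
  qed
  also have "\<dots> \<le> (G / k) powr ((1 - p) / p) * G"
    unfolding sum_distrib_left[symmetric] using M_le G(2) by (intro mult_mono sum_nonneg) auto
  also have "\<dots> = (1 / k) powr ((1 - p) / p) * (G powr ((1 - p) / p) * G powr 1)"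
    using G0 by (simp add: powr_divide)
  also have "G powr ((1 - p) / p) * G powr 1 = G powr ((1 - p) / p + 1)"
    by (rule powr_add[symmetric])
  also have "(1 - p) / p + 1 = 1 / p"
    using p by (simp add: field_simps)
  also have "(1 / real k) powr ((1 - p) / p) = real k powr ((p - 1) / p)"
    using powr_minus_divide[of "real k" "(1 - p) / p"] by (simp add: powr_divide minus_divide_left)
  finally show ?thesis .
qed

theorem theorem6p5:
  fixes p q \<beta> \<epsilon> \<delta> \<theta> :: real
    and A :: "real ^ 'n ^ 'm" and b :: "real ^ 'm"
    and x xhat xmax :: "real ^ 'n"
    and k t :: nat
    and a vtheta \<eta> \<tau> \<psi> C1 C2 :: real
  assumes p: "0 < p" "p \<le> 1" and q: "1 < q" and beta: "0 < \<beta>" and eps: "0 \<le> \<epsilon>"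
    and x_nz: "x \<noteq> 0"
    and x_feasible: "norm (b - A *v x) \<le> \<epsilon>"
    and x_ratio: "lp_norm p x / lp_norm q x \<le> \<beta>"
    and xhat: "is_arg_min (\<lambda>z. lp_norm p z powr p / lp_norm q z powr p)
                 (\<lambda>z. z \<noteq> 0 \<and> norm (A *v z - b) \<le> \<epsilon>) xhat"
    and k: "1 \<le> k" "k < CARD('n)"
    and t: "1 \<le> t" "t \<le> CARD('n) - k"
    and xmax: "is_max_part k x xmax"
    and a_def: "a = 3 powr ((1 - p) / p)"
    and vtheta_def: "vtheta = max (1 / q - 1 / 2) 0"
    and eta_def: "\<eta> = a * \<beta> * real k powr ((p - 1) / p) * real t powr (vtheta - 1 / 2)"
    and tau_def: "\<tau> = (a * sqrt (real k / real t) + 1 / 4 * sqrt (real t / real k)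
                    + a * \<beta> * real k powr ((p - 1) / p + vtheta) * real t powr (- 1 / 2)) / (1 - \<eta>)"
    and psi_def: "\<psi> = \<delta> + \<tau> * \<theta>"
    and rip: "satisfies_RIP A k \<delta>"
    and rop: "satisfies_ROP A k t \<theta>"
    and eta_lt: "\<eta> < 1"
    and psi_lt: "\<psi> < 1"
    and C1_def: "C1 = a * 2 powr (1 / p) * real k powr ((p - 1) / p) * real t powr (- 1 / 2)
                    * (1 - \<delta> + \<theta>) / ((1 - \<eta>) * (1 - \<psi>))"
    and C2_def: "C2 = 2 * (1 + \<tau>) * sqrt (1 + \<delta>) / (1 - \<psi>)"
  shows "norm (xhat - x) \<le> C1 * lp_norm p (x - xmax) + C2 * \<epsilon>"
proof -

  \<comment> \<open>The error vector and its largest entries\<close>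
  define h where "h = xhat - x"
  have xhat_eq: "xhat = x + h" by (simp add: h_def)
  have xhat_nz: "x + h \<noteq> 0" and xhat_feasible: "norm (A *v xhat - b) \<le> \<epsilon>"
    using xhat by (auto simp: is_arg_min_def xhat_eq)
  have opt: "lp_norm p (x + h) powr p / lp_norm q (x + h) powr p \<le> lp_norm p x powr p / lp_norm q x powr p"
    using xhat x_nz x_feasible unfolding is_arg_min_def xhat_eq
    by (metis norm_minus_commute not_less)
  obtain S where S: "card S = k" "xmax = vec_restrict S x"
    using xmax unfolding is_max_part_def vec_restrict_def by blast
  define \<sigma> where "\<sigma> = lp_norm p (x - xmax)"
  have \<sigma>: "\<sigma> powr p = (\<Sum>i\<in>- S. \<bar>x $ i\<bar> powr p)"
  proof -
    have "\<sigma> powr p = (\<Sum>i\<in>UNIV. \<bar>(x - xmax) $ i\<bar> powr p)"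
      using p by (simp add: \<sigma>_def lp_norm_eq_lp_norm_on lp_norm_on_powr)
    also have "\<dots> = (\<Sum>i\<in>- S. \<bar>x $ i\<bar> powr p)"
      by (intro sum.mono_neutral_cong_right) (auto simp: S)
    finally show ?thesis .
  qed
  have \<sigma>0: "0 \<le> \<sigma>" by (simp add: \<sigma>_def lp_norm_eq_lp_norm_on)
  obtain T where T: "card T = k" "\<And>i j. i \<in> T \<Longrightarrow> j \<notin> T \<Longrightarrow> \<bar>h $ j\<bar> \<le> \<bar>h $ i\<bar>"
    using ex_top_subset[of UNIV k "\<lambda>i. \<bar>h $ i\<bar>"] k by auto
  let ?H = "lp_norm q h"
  have H0: "0 \<le> ?H" by (simp add: lp_norm_eq_lp_norm_on)
  define N where "N = L2_set (($) h) T"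
  have N0: "0 \<le> N" by (simp add: N_def)
  define HT where "HT = lp_norm_on p T (($) h)"
  have HT: "HT powr p = (\<Sum>i\<in>T. \<bar>h $ i\<bar> powr p)" using p by (simp add: HT_def lp_norm_on_powr)
  \<comment> \<open>Written as three \<open>p\<close>-th powers to fit
    \<open>powr_inverse_sum3_le\<close>: the factor 2 of the cone constraint becomes
    \<open>2 powr (1 / p)\<close>, which reappears in \<open>C1\<close>.\<close>
  define G where "G = HT powr p + (2 powr (1 / p) * \<sigma>) powr p + (\<beta> * ?H) powr p"
  have G: "G = (\<Sum>i\<in>T. \<bar>h $ i\<bar> powr p) + 2 * \<sigma> powr p + \<beta> powr p * ?H powr p"
    using p by (simp add: G_def HT powr_mult powr_powr)
  have tail: "(\<Sum>i\<in>- T. \<bar>h $ i\<bar> powr p) \<le> G"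
  proof -
    have split: "(\<Sum>i\<in>UNIV. \<bar>h $ i\<bar> powr p) = (\<Sum>i\<in>U. \<bar>h $ i\<bar> powr p) + (\<Sum>i\<in>- U. \<bar>h $ i\<bar> powr p)" for U
      by (simp add: Compl_eq_Diff_UNIV sum.subset_diff[of U UNIV])
    \<comment> \<open>The cone constraint concerns \<open>S\<close>. It passes to \<open>T\<close>
      because \<open>T\<close> carries at least as much \<open>p\<close>-mass of \<open>h\<close>
      and the total mass is fixed.\<close>
    have "(\<Sum>i\<in>S. \<bar>h $ i\<bar> powr p) \<le> (\<Sum>i\<in>T. \<bar>h $ i\<bar> powr p)"
      using S(1) T p by (intro sum_le_sum_top powr_mono2) auto
    then show ?thesis
      using cone_constraint[OF p q x_nz xhat_nz x_ratio opt, of S] split[of S] split[of T]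
      by (simp add: G \<sigma>)
  qed
  define M where "M = Max ((\<lambda>i. \<bar>h $ i\<bar>) ` (- T))"
  have "T \<noteq> UNIV" using T(1) k by auto
  then have "- T \<noteq> {}" by blast
  then have "M \<in> (\<lambda>i. \<bar>h $ i\<bar>) ` (- T)" unfolding M_def by (intro Max_in) auto
  then have M: "0 \<le> M" "\<And>i. i \<in> T \<Longrightarrow> M \<le> \<bar>h $ i\<bar>"
    using T(2) by auto
  have M_ge: "\<bar>h $ j\<bar> \<le> M" if "j \<notin> T" for j
    using that unfolding M_def by (intro Max_ge) auto
  define kp where "kp = real k powr ((p - 1) / p)"
  have l1: "(\<Sum>i\<in>- T. \<bar>h $ i\<bar>) \<le> kp * G powr (1 / p)"
    unfolding kp_def using p T(1) k(1) M M_ge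
    by (rule l1_tail_le) (use tail in \<open>auto simp: G\<close>)
  have "G powr (1 / p) \<le> a * (HT + 2 powr (1 / p) * \<sigma> + \<beta> * ?H)"
    unfolding G_def a_def using p \<sigma>0 H0 beta by (intro powr_inverse_sum3_le) (auto simp: HT_def)
  also have "HT \<le> real k powr (1 / p - 1 / 2) * N"
    using lp_norm_on_power_mean[of T p 2 k "($) h"] p T by (simp add: HT_def N_def lp_norm_on_two)
  finally have G_le: "G powr (1 / p) \<le> a * (real k powr (1 / p - 1 / 2) * N + 2 powr (1 / p) * \<sigma> + \<beta> * ?H)"
    by (simp add: a_def)

  \<comment> \<open>Block decomposition of the error\<close>
  obtain P where P: "partition_on (- T) P" "\<And>B. B \<in> P \<Longrightarrow> card B \<le> t"
    and P_le: "(\<Sum>B\<in>P. L2_set (($) h) B) \<le> (\<Sum>i\<in>- T. \<bar>h $ i\<bar>) / sqrt t + sqrt t / 4 * M"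
    using block_decomposition[of "- T" t M "($) h"] M M_ge t by auto
  define X where "X = (\<Sum>B\<in>P. L2_set (($) h) B)"
  have X0: "0 \<le> X" by (simp add: X_def sum_nonneg)
  have part: "partition_on UNIV (insert T P)" "T \<notin> P" "finite P"
  proof -
    have "T \<noteq> {}" using T k by auto
    then show "partition_on UNIV (insert T P)" "T \<notin> P"
      using P(1) by (auto simp: partition_on_def disjoint_def)
    show "finite P" by simp
  qed
  \<comment> \<open>With \<open>T\<close> as one more block, passing from \<open>q\<close>-norms to
    Euclidean norms costs \<open>k powr vtheta\<close> on \<open>T\<close> and
    \<open>t powr vtheta\<close> on the others.\<close>
  have H_le: "?H \<le> real k powr vtheta * N + real t powr vtheta * X"
  proof -
    have "?H \<le> (\<Sum>B\<in>insert T P. lp_norm_on q B (($) h))"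
      unfolding lp_norm_eq_lp_norm_on using part q by (intro lp_norm_on_le_sum_partition) auto
    also have "\<dots> = lp_norm_on q T (($) h) + (\<Sum>B\<in>P. lp_norm_on q B (($) h))"
      using part by simp
    also have "\<dots> \<le> real k powr vtheta * N + (\<Sum>B\<in>P. real t powr vtheta * L2_set (($) h) B)"
      unfolding N_def vtheta_def using T P k t q
      by (intro add_mono sum_mono lp_norm_on_le_L2_set) auto
    finally show ?thesis by (simp add: X_def sum_distrib_left)
  qed
  have norm_h: "norm h \<le> N + X"
    using lp_norm_on_le_sum_partition[OF finite part(1), of 2 "($) h"] part
    by (simp add: norm_eq_lp_norm_on N_def X_def lp_norm_on_two)
  \<comment> \<open>\<open>N\<close> is the root of a sum of \<open>k\<close> squares, each at least
    the square of \<open>M\<close>. This leads to the term with \<open>sqrt (t / k)\<close> in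
    \<open>\<tau>\<close>.\<close>
  have M_N: "M \<le> N / sqrt k"
  proof -
    have "real k * M\<^sup>2 \<le> (\<Sum>i\<in>T. (h $ i)\<^sup>2)"
      using sum_mono[of T "\<lambda>_. M\<^sup>2" "\<lambda>i. (h $ i)\<^sup>2"] M T by (simp add: abs_le_square_iff[symmetric])
    then have "sqrt (real k * M\<^sup>2) \<le> N" by (simp add: N_def L2_set_def)
    then show ?thesis using M(1) k by (simp add: real_sqrt_mult field_simps)
  qed
  define E where "E = a * 2 powr (1 / p) * kp * real t powr (- 1 / 2) * \<sigma> / (1 - \<eta>)"
  have t_half: "real t powr (- 1 / 2) = 1 / sqrt t"
    using t by (simp add: powr_minus_divide powr_half_sqrt)
  have kp_half: "kp * real k powr (1 / p - 1 / 2) = sqrt k"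
  proof -
    have "kp * real k powr (1 / p - 1 / 2) = real k powr ((p - 1) / p + (1 / p - 1 / 2))"
      by (simp only: kp_def powr_add)
    also have "(p - 1) / p + (1 / p - 1 / 2) = 1 / 2" using p by (simp add: field_simps)
    finally show ?thesis by (simp add: powr_half_sqrt)
  qed
  have a0: "0 < a" and kp0: "0 < kp" using k by (simp_all add: a_def kp_def)
  have X_le: "X \<le> \<tau> * N + E"
  proof -
    \<comment> \<open>\<open>X\<close> occurs on both sides because \<open>lp_norm q h\<close> was
      estimated by \<open>N\<close> and \<open>X\<close>. After regrouping, the coefficient of
      \<open>X\<close> is \<open>\<eta>\<close>, that of \<open>N\<close> is
      \<open>\<tau> * (1 - \<eta>)\<close>, and the rest is \<open>E * (1 - \<eta>)\<close>.\<close>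
    have "X \<le> kp * (a * (real k powr (1 / p - 1 / 2) * N + 2 powr (1 / p) * \<sigma>
        + \<beta> * (real k powr vtheta * N + real t powr vtheta * X))) / sqrt t + sqrt t / 4 * (N / sqrt k)"
    proof -
      have "X \<le> (\<Sum>i\<in>- T. \<bar>h $ i\<bar>) / sqrt t + sqrt t / 4 * M" using P_le by (simp add: X_def)
      also have "\<dots> \<le> kp * G powr (1 / p) / sqrt t + sqrt t / 4 * (N / sqrt k)"
        using l1 M_N by (intro add_mono divide_right_mono mult_left_mono) auto
      also have "G powr (1 / p) \<le> a * (real k powr (1 / p - 1 / 2) * N + 2 powr (1 / p) * \<sigma>
          + \<beta> * (real k powr vtheta * N + real t powr vtheta * X))"
        using G_le H_le a0 beta by (smt (verit) mult_left_mono)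
      finally show ?thesis using kp0 by (simp add: divide_right_mono mult_left_mono)
    qed
    also have "\<dots> = (a * (kp * real k powr (1 / p - 1 / 2)) / sqrt t + 1 / 4 * (sqrt t / sqrt k)
          + a * \<beta> * (kp * real k powr vtheta) * (1 / sqrt t)) * N
        + a * 2 powr (1 / p) * kp * (1 / sqrt t) * \<sigma>
        + a * \<beta> * kp * (real t powr vtheta * (1 / sqrt t)) * X"
      by (simp add: algebra_simps add_divide_distrib)
    also have "a * \<beta> * kp * (real t powr vtheta * (1 / sqrt t)) = \<eta>"
      by (simp add: eta_def kp_def powr_diff powr_half_sqrt)
    also have "a * (kp * real k powr (1 / p - 1 / 2)) / sqrt t + 1 / 4 * (sqrt t / sqrt k)
          + a * \<beta> * (kp * real k powr vtheta) * (1 / sqrt t) = \<tau> * (1 - \<eta>)"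
      using eta_lt unfolding kp_half tau_def t_half
      by (simp add: kp_def powr_add real_sqrt_divide)
    also have "a * 2 powr (1 / p) * kp * (1 / sqrt t) * \<sigma> = E * (1 - \<eta>)"
      using eta_lt unfolding E_def t_half by simp
    finally have "X * (1 - \<eta>) \<le> (\<tau> * N + E) * (1 - \<eta>)" by (simp add: algebra_simps)
    then show ?thesis using eta_lt by simp
  qed

  \<comment> \<open>Combination with RIP and ROP\<close>
  have \<delta>: "0 \<le> \<delta>" and ric: "ric_bound A k \<delta>"
    using rip ric_least(1)[OF k(1)] by (auto simp: satisfies_RIP_def)
  have roc: "roc_bound A k t \<theta>" using rop roc_least(1) by (simp add: satisfies_ROP_def)
  then have \<theta>: "0 \<le> \<theta>" by (simp add: roc_bound_def)
  have \<tau>: "0 \<le> \<tau>" using eta_lt beta a0 by (simp add: tau_def)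
  have "A *v h = (A *v xhat - b) + (b - A *v x)"
    by (simp add: h_def matrix_vector_mult_diff_distrib)
  then have "norm (A *v h) \<le> 2 * \<epsilon>"
    using norm_triangle_ineq[of "A *v xhat - b" "b - A *v x"] xhat_feasible x_feasible by simp
  then have "(1 - \<delta>) * N \<le> \<theta> * X + 2 * \<epsilon> * sqrt (1 + \<delta>)"
    unfolding N_def X_def using ric roc \<delta> T(1) P by (intro rip_rop_bound)
  \<comment> \<open>Moving \<open>\<theta> * \<tau> * N\<close> to the left turns
    \<open>1 - \<delta>\<close> into \<open>1 - \<psi>\<close>.\<close>
  also have "\<theta> * X \<le> \<theta> * (\<tau> * N + E)" using X_le \<theta> by (rule mult_left_mono)
  finally have N_le: "(1 - \<psi>) * N \<le> \<theta> * E + 2 * \<epsilon> * sqrt (1 + \<delta>)"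
    by (simp add: psi_def algebra_simps)
  have "norm h \<le> (1 + \<tau>) * N + E" using norm_h X_le by (simp add: algebra_simps)
  then have "(1 - \<psi>) * norm h \<le> (1 + \<tau>) * ((1 - \<psi>) * N) + (1 - \<psi>) * E"
    using psi_lt by (simp add: mult.left_commute mult_left_mono flip: distrib_left)
  also have "\<dots> \<le> (1 + \<tau>) * (\<theta> * E + 2 * \<epsilon> * sqrt (1 + \<delta>)) + (1 - \<psi>) * E"
    using N_le \<tau> by (simp add: mult_left_mono)
  \<comment> \<open>The coefficient of \<open>E\<close> is
    \<open>(1 + \<tau>) * \<theta> + (1 - \<psi>)\<close>, in which \<open>\<tau> * \<theta>\<close>
    cancels.\<close>
  also have "\<dots> = (1 - \<delta> + \<theta>) * E + 2 * (1 + \<tau>) * sqrt (1 + \<delta>) * \<epsilon>"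
    by (simp add: psi_def algebra_simps)
  finally have "norm h \<le> (1 - \<delta> + \<theta>) * E / (1 - \<psi>) + 2 * (1 + \<tau>) * sqrt (1 + \<delta>) * \<epsilon> / (1 - \<psi>)"
    using psi_lt by (simp add: pos_le_divide_eq mult.commute flip: add_divide_distrib)
  also have "(1 - \<delta> + \<theta>) * E / (1 - \<psi>) = C1 * \<sigma>"
    by (simp add: C1_def E_def kp_def)
  also have "2 * (1 + \<tau>) * sqrt (1 + \<delta>) * \<epsilon> / (1 - \<psi>) = C2 * \<epsilon>"
    by (simp add: C2_def)
  finally show ?thesis by (simp add: h_def \<sigma>_def)
qed

end
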